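(* Let $d(x),g(x)\in\mathbb{Z}[x]$ be non-zero polynomials with $\gcd(d(x),g(x))=1$ and $\deg(g)<\deg(d)$, and let $(\mathcal{F}_n(x))_{n\ge 0}$ be the Fibonacci-type polynomial sequence determined by $d(x)$ and $g(x)$. Let $m(x)$ be a polynomial in $\mathbb{Z}[x]$ and let $p$ be an odd number. If $g(x)=-m(x)^2$, then $\mathcal{F}_p(x)$ is reducible over $\mathbb{Q}$.
   Context: The Fibonacci-type polynomial sequence determined by $d(x),g(x)$ is defined by $\mathcal{F}_0(x)=0$, $\mathcal{F}_1(x)=1$, and $\mathcal{F}_n(x)=d(x)\mathcal{F}_{n-1}(x)+g(x)\mathcal{F}_{n-2}(x)$ for $n\ge 2$. *)

theory Defs
  imports "HOL-Computational_Algebra.Computational_Algebra"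
begin

fun fib_type_poly :: "int poly \<Rightarrow> int poly \<Rightarrow> nat \<Rightarrow> int poly" where
  "fib_type_poly d g 0 = 0"
| "fib_type_poly d g (Suc 0) = 1"
| "fib_type_poly d g (Suc (Suc n)) = d * fib_type_poly d g (Suc n) + g * fib_type_poly d g n"

abbreviation to_rat_poly :: "int poly \<Rightarrow> rat poly" where
  "to_rat_poly f \<equiv> map_poly rat_of_int f"

text \<open>Zero and units are neither irreducible nor reducible.\<close>
definition reducible_over_Q :: "int poly \<Rightarrow> bool" where
  "reducible_over_Q f \<longleftrightarrow>
     to_rat_poly f \<noteq> 0 \<and> \<not> is_unit (to_rat_poly f) \<and> \<not> irreducible (to_rat_poly f)"

end

theory Submission
  imports Defs
begin

text \<open>
  Write \<open>p = 2k + 1\<close>. The addition formula gives \<open>F\<^sub>p = F\<^sub>k\<^sub>+\<^sub>1\<^sup>2 + g F\<^sub>k\<^sup>2\<close>, which for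
  \<open>g = - m\<^sup>2\<close> is the difference of squares \<open>(F\<^sub>k\<^sub>+\<^sub>1 - m F\<^sub>k) (F\<^sub>k\<^sub>+\<^sub>1 + m F\<^sub>k)\<close>. Since
  \<open>deg m < deg d\<close>, the term \<open>F\<^sub>k\<^sub>+\<^sub>1\<close> dominates, so both factors have degree \<open>k deg d\<close>.
\<close>

text \<open>The induction shifts one index from \<open>m\<close> to \<open>n\<close>: expanding the
  \<open>n + 2\<close> term by the recurrence and regrouping yields the \<open>m + 2\<close>
  term.\<close>

lemma fib_type_poly_add:
  "fib_type_poly d g (Suc (m + n)) =
     fib_type_poly d g (Suc m) * fib_type_poly d g (Suc n) +
     g * fib_type_poly d g m * fib_type_poly d g n"
proof (induction m arbitrary: n)
  case (Suc m)
  show ?case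
    using Suc.IH[of "Suc n"] by (simp add: algebra_simps)
qed simp

lemma degree_fib_type_poly:
  assumes "degree g < degree d"
  shows "degree (fib_type_poly d g (Suc n)) = n * degree d"
proof -
  \<comment> \<open>Nonvanishing is carried along so that degrees add in the product with
    \<open>d\<close>, which outweighs the \<open>g\<close> summand.\<close>
  have "fib_type_poly d g (Suc n) \<noteq> 0 \<and> degree (fib_type_poly d g (Suc n)) = n * degree d"
  proof (induction n rule: induct_nat_012)
    case (ge2 n)
    let ?F = "fib_type_poly d g"
    have lead: "degree (d * ?F (Suc (Suc n))) = Suc (Suc n) * degree d"
      using ge2 assms by (subst degree_mult_eq) auto
    have "degree (g * ?F (Suc n)) \<le> degree g + degree (?F (Suc n))"
      by (rule degree_mult_le)
    also have "\<dots> < Suc (Suc n) * degree d"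
      using ge2 assms by simp
    finally have "degree (g * ?F (Suc n)) < degree (d * ?F (Suc (Suc n)))"
      using lead by simp
    then have "degree (?F (Suc (Suc (Suc n)))) = Suc (Suc n) * degree d"
      using lead by (simp add: degree_add_eq_left)
    with assms show ?case by force
  qed (use assms in auto)
  then show ?thesis by simp
qed

text \<open>The second summand has degree at most \<open>degree m + (k - 1) * degree d\<close>. Used
  with both \<open>m\<close> and \<open>- m\<close>, for the two factors.\<close>

lemma degree_fib_type_poly_add_mult:
  assumes "degree g < degree d" "degree m < degree d" "k > 0"
  shows "degree (fib_type_poly d g (Suc k) + m * fib_type_poly d g k) = k * degree d"
proof -
  obtain j where k: "k = Suc j"
    using \<open>k > 0\<close> gr0_implies_Suc by blast
  have "degree (m * fib_type_poly d g k) \<le> degree m + degree (fib_type_poly d g k)"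
    by (rule degree_mult_le)
  also have "\<dots> < k * degree d"
    using assms by (simp add: k degree_fib_type_poly del: fib_type_poly.simps)
  finally show ?thesis
    using assms(1) by (simp add: degree_add_eq_left degree_fib_type_poly del: fib_type_poly.simps)
qed

lemma to_rat_poly_mult: "to_rat_poly (f * h) = to_rat_poly f * to_rat_poly h"
  by (rule poly_eqI) (simp add: coeff_map_poly coeff_mult)

text \<open>Passing to rational coefficients preserves degrees, and nonconstant polynomials over a
  field are nonzero nonunits.\<close>

lemma reducible_over_Q_mult:
  assumes "degree f > 0" "degree h > 0"
  shows "reducible_over_Q (f * h)"
proof -
  have deg: "degree (to_rat_poly f) > 0" "degree (to_rat_poly h) > 0"
    using assms by (simp_all add: degree_map_poly)
  then have nz: "to_rat_poly f \<noteq> 0" "to_rat_poly h \<noteq> 0"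
    and nu: "\<not> is_unit (to_rat_poly f)" "\<not> is_unit (to_rat_poly h)"
    by (auto simp: is_unit_poly_iff)
  then show ?thesis
    unfolding reducible_over_Q_def to_rat_poly_mult
    by (auto dest: irreducibleD simp: is_unit_mult_iff)
qed

theorem proposition3p3:
  fixes d g m :: "int poly" and p :: nat
  assumes "d \<noteq> 0" and "g \<noteq> 0"
    and "gcd d g = 1"
    and "degree g < degree d"
    and "odd p"
    and "g = - (m ^ 2)"
  shows "\<not> irreducible (to_rat_poly (fib_type_poly d g p)) \<and>
         (p \<noteq> 1 \<longrightarrow> reducible_over_Q (fib_type_poly d g p))"
proof (cases "p = 1")
  \<comment> \<open>Here the polynomial is \<open>1\<close>, a unit: not irreducible, but not
    reducible either.\<close>
  case True
  then show ?thesis by simp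
next
  case False
  let ?F = "fib_type_poly d g"
  obtain k where p: "p = Suc (k + k)"
    using \<open>odd p\<close> by (auto elim!: oddE simp: mult_2)
  with False have "k > 0" by simp
  have factor: "?F p = (?F (Suc k) + - m * ?F k) * (?F (Suc k) + m * ?F k)"
    unfolding p fib_type_poly_add using \<open>g = - (m ^ 2)\<close>
    by (simp add: algebra_simps power2_eq_square del: fib_type_poly.simps)
  \<comment> \<open>This transfers the degree bound from \<open>g\<close> to
    \<open>m\<close>.\<close>
  have "degree g = 2 * degree m"
    using \<open>g = - (m ^ 2)\<close> \<open>g \<noteq> 0\<close> by (simp add: degree_power_eq)
  then have "degree m < degree d" "degree (- m) < degree d"
    using \<open>degree g < degree d\<close> by simp_all
  then have "reducible_over_Q (?F p)"
    unfolding factor using \<open>degree g < degree d\<close> \<open>k > 0\<close>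
    by (intro reducible_over_Q_mult) (simp_all only: degree_fib_type_poly_add_mult, simp_all)
  then show ?thesis
    by (simp add: reducible_over_Q_def)
qed

end
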